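(* Let $\ell\ge3$ and let $\lambda$ be a partition. Then $\mathcal S\lambda$ is the unique smallest partition in its regularization class $\mathcal{RC}(\lambda)$ with respect to dominance order. It can be characterized as the unique partition in its regularization class all of whose boxes are locked.
   Context: Positions $(a,b)$, $a,b\ge1$, are in row $a$ (rows numbered downward) and column $b$. The ladder of $(a,b)$ is the set of all positions $(c,d)$, $c,d\ge 1$, with $c-a=(\ell-1)(b-d)$. The regularization $\mathcal R\lambda$ of a partition $\lambda$ is the partition obtained by moving all boxes of $\lambda$ up to the top of their respective ladders (so each ladder contains the same number of boxes, placed in its highest positions). The regularization class of $\lambda$ is $\mathcal{RC}(\lambda)=\{\mu:\mathcal R\mu=\mathcal R\lambda\}$. Dominance order on partitions of $n$: $\lambda\le\mu$ if $\sum_{j\le i}\lambda_j\le\sum_{j\le i}\mu_j$ for all $i$. Locked boxes of $\lambda$ are determined by the following procedure (the set of locked boxes is the smallest set closed under these rules): (I) if a box $x$ of $\lambda$ lies in the first row or has a locked box directly above it, and every unoccupied position in the same ladder as $x$ lying below $x$ has an unoccupied position directly above it, then $x$ is locked; (II) if a box $y$ is locked, then every box to the left of $y$ in the same row is locked. Boxes of $\lambda$ that are not locked are unlocked. $\mathcal S\lambda$ is the diagram obtained from $\lambda$ by keeping all locked boxes in place and moving all unlocked boxes down their ladders as far as possible, keeping them in order: on each ladder, the unlocked boxes are moved to the lowest positions of that ladder not occupied by locked boxes. *)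

theory Defs
  imports Main
begin

text \<open>
  Positions are pairs (row, column), both counted from 1, with rows numbered downward.
  A partition is identified with its Young diagram, the set of its boxes; the part
  \<open>lam\<^sub>i\<close> is recovered as \<open>part lam i\<close>.
\<close>

type_synonym position = "nat \<times> nat"

definition is_position :: "position \<Rightarrow> bool" where
  "is_position x \<longleftrightarrow> 1 \<le> fst x \<and> 1 \<le> snd x"

definition young_diagram :: "nat list \<Rightarrow> position set" where
  "young_diagram ps = {(i, j). 1 \<le> i \<and> i \<le> length ps \<and> 1 \<le> j \<and> j \<le> ps ! (i - 1)}"

definition is_partition :: "position set \<Rightarrow> bool" where
  "is_partition lam \<longleftrightarrow>
    (\<exists>ps. sorted_wrt (\<ge>) ps \<and> (\<forall>p\<in>set ps. 0 < p) \<and> lam = young_diagram ps)"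

definition part :: "position set \<Rightarrow> nat \<Rightarrow> nat" where
  "part lam i = card {j. (i, j) \<in> lam}"

definition dominance_le :: "position set \<Rightarrow> position set \<Rightarrow> bool" where
  "dominance_le lam mu \<longleftrightarrow>
    card lam = card mu \<and> (\<forall>i. (\<Sum>j = 1..i. part lam j) \<le> (\<Sum>j = 1..i. part mu j))"

definition ladder :: "nat \<Rightarrow> position \<Rightarrow> position set" where
  "ladder l x = {y. is_position y \<and>
     int (fst y) - int (fst x) = (int l - 1) * (int (snd x) - int (snd y))}"

text \<open>
  For \<open>l \<ge> 2\<close> every ladder is finite and its positions lie in distinct rows. The \<open>k\<close> highest
  positions of a ladder are thus those that have fewer than \<open>k\<close> positions of the ladder above
  them; \<open>k\<close> is the number of boxes of \<open>lam\<close> on the ladder.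
\<close>

definition regularization :: "nat \<Rightarrow> position set \<Rightarrow> position set" where
  "regularization l lam = {x. is_position x \<and>
     card {y \<in> ladder l x. fst y < fst x} < card (ladder l x \<inter> lam)}"

definition reg_class :: "nat \<Rightarrow> position set \<Rightarrow> position set set" where
  "reg_class l lam = {mu. is_partition mu \<and> regularization l mu = regularization l lam}"

inductive_set locked :: "nat \<Rightarrow> position set \<Rightarrow> position set"
  for l :: nat and lam :: "position set"
where
  lock_column:
    "(a, b) \<in> lam \<Longrightarrow> a = 1 \<or> (a - 1, b) \<in> locked l lam \<Longrightarrow>
     \<forall>(c, d) \<in> ladder l (a, b). c > a \<and> (c, d) \<notin> lam \<longrightarrow> (c - 1, d) \<notin> lam \<Longrightarrow>
     (a, b) \<in> locked l lam"
| lock_row: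
    "(a, b) \<in> locked l lam \<Longrightarrow> (a, d) \<in> lam \<Longrightarrow> d < b \<Longrightarrow> (a, d) \<in> locked l lam"

text \<open>
  On each ladder, the \<open>k\<close> unlocked boxes go to the \<open>k\<close> lowest positions not occupied by locked
  boxes, i.e. to those with fewer than \<open>k\<close> such positions below them.
\<close>

definition lowering :: "nat \<Rightarrow> position set \<Rightarrow> position set" where
  "lowering l lam = locked l lam \<union> {x. is_position x \<and> x \<notin> locked l lam \<and>
     card {y \<in> ladder l x. fst x < fst y \<and> y \<notin> locked l lam}
       < card (ladder l x \<inter> (lam - locked l lam))}"

end

(* Put m = l - 1. If column b of a partition has height h b, let s b = h b + m * b. The
   partitions are the sequences s with s (b + 1) <= s b + m and s b = m * b for large b, and
   two of them have the same number of boxes on every ladder iff the multisets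
   {s 1, ..., s N} agree for large N. So a regularization class consists of the admissible
   arrangements of a fixed multiset, read from the right, starting at m * (N + 1) and never
   dropping by more than m.

   The locked boxes are the diagram of the sequence q with q b the least s i (i <= b) that is
   at least q (b + 1) - m. Hence all boxes are locked iff the arrangement is greedy: from right
   to left it always takes the least admissible remaining value. After each step the greedy
   arrangement g has, for every v, used at least as many values below v as any other one. This
   gives uniqueness, and counting on each ladder it gives dominance minimality. Finally, if
   g e < g d for some e < d, then q d = g d; so on every ladder the boxes of g that are
   not locked in s fill the lowest positions, i.e. g is the lowering of s. *)

theory Submission
  imports Defs "HOL-Library.Multiset"
begin

section \<open>Partitions as finite down-closed sets of positions\<close>

lemma initial_segment_eq:
  fixes A :: "nat set"
  assumes "finite A" "0 \<notin> A" and down: "\<And>i j. j \<in> A \<Longrightarrow> 1 \<le> i \<Longrightarrow> i \<le> j \<Longrightarrow> i \<in> A"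
  shows "A = {1..card A}"
proof (cases "A = {}")
  case False
  have "A = {1..Max A}"
  proof
    show "A \<subseteq> {1..Max A}"
      using assms(1,2) by (force simp: Suc_le_eq intro: gr0I)
    show "{1..Max A} \<subseteq> A"
      using down[OF Max_in[OF assms(1) False]] by auto
  qed
  then show ?thesis
    by (metis card_atLeastAtMost diff_Suc_1)
qed auto

text \<open>Down-closure treats rows and columns alike, so a partition given by its list of rows can
  afterwards be read off column by column.\<close>

lemma is_partition_iff_down_closed:
  "is_partition lam \<longleftrightarrow> finite lam \<and> (\<forall>x\<in>lam. is_position x) \<and>
    (\<forall>a b a' b'. (a, b) \<in> lam \<longrightarrow> 1 \<le> a' \<longrightarrow> a' \<le> a \<longrightarrow> 1 \<le> b' \<longrightarrow> b' \<le> b \<longrightarrow> (a', b') \<in> lam)"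
  (is "?L \<longleftrightarrow> ?R")
proof
  assume ?L
  then obtain ps where ps: "sorted_wrt (\<ge>) ps" "lam = young_diagram ps"
    by (auto simp: is_partition_def)
  have "lam \<subseteq> (SIGMA i:{1..length ps}. {1..ps ! (i - 1)})"
    by (auto simp: ps(2) young_diagram_def)
  then have "finite lam"
    by (rule finite_subset) auto
  moreover have "(a', b') \<in> lam"
    if "(a, b) \<in> lam" "1 \<le> a'" "a' \<le> a" "1 \<le> b'" "b' \<le> b" for a b a' b'
  proof -
    have "ps ! (a - 1) \<le> ps ! (a' - 1)"
    proof (cases "a' = a")
      case False
      then have "a' - 1 < a - 1" "a - 1 < length ps"
        using that by (auto simp: ps(2) young_diagram_def)
      then show ?thesis
        using sorted_wrt_nth_less[OF ps(1)] by blast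
    qed auto
    then show ?thesis
      using that by (auto simp: ps(2) young_diagram_def)
  qed
  ultimately show ?R
    by (auto simp: ps(2) young_diagram_def is_position_def)
next
  assume R: ?R
  then have pos: "1 \<le> a \<and> 1 \<le> b" if "(a, b) \<in> lam" for a b
    using that by (force simp: is_position_def)
  have down: "(a', b') \<in> lam"
    if "(a, b) \<in> lam" "1 \<le> a'" "a' \<le> a" "1 \<le> b'" "b' \<le> b" for a b a' b'
    using R that by blast
  have finlam: "finite lam"
    using R by blast
  define R where "R i = {j. (i, j) \<in> lam}" for i
  define k where "k = card {i. (i, 1) \<in> lam}"
  have "R i \<subseteq> snd ` lam" for i
    by (force simp: R_def)
  then have finR: "finite (R i)" for i
    using finlam by (rule finite_subset[OF _ finite_imageI])
  have row: "R i = {1..card (R i)}" for i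
  proof (rule initial_segment_eq)
    show "0 \<notin> R i"
      using pos[of i 0] by (auto simp: R_def)
    show "j' \<in> R i" if "j \<in> R i" "1 \<le> j'" "j' \<le> j" for j j'
      using that down[of i j i j'] pos[of i j] by (auto simp: R_def)
  qed (rule finR)
  have col: "{i. (i, 1) \<in> lam} = {1..k}"
    unfolding k_def
  proof (rule initial_segment_eq)
    have "{i. (i, 1) \<in> lam} \<subseteq> fst ` lam"
      by force
    then show "finite {i. (i, 1) \<in> lam}"
      using finlam by (rule finite_subset[OF _ finite_imageI])
    show "0 \<notin> {i. (i, 1) \<in> lam}"
      using pos[of 0 1] by auto
    show "i' \<in> {i. (i, 1) \<in> lam}" if "i \<in> {i. (i, 1) \<in> lam}" "1 \<le> i'" "i' \<le> i" for i i'
      using that down[of i 1 i' 1] by auto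
  qed
  \<comment> \<open>Rows are numbered from 1 and list entries from 0, hence \<open>Suc i\<close>.
    The length \<open>k\<close> of the first column is the number of nonempty rows.\<close>
  define ps where "ps = map (\<lambda>i. card (R (Suc i))) [0..<k]"
  have "R (Suc j) \<subseteq> R (Suc i)" if "i < j" for i j
    using down[of "Suc j" _ "Suc i"] pos that by (auto simp: R_def)
  then have "sorted_wrt (\<ge>) ps"
    using finR by (auto simp: ps_def sorted_wrt_map sorted_wrt_iff_nth_less card_mono)
  moreover have "\<forall>p\<in>set ps. 0 < p"
  proof -
    have "1 \<in> R (Suc i)" if "i < k" for i
      using that col by (auto simp: R_def)
    then have "0 < card (R (Suc i))" if "i < k" for i
      using that finR card_gt_0_iff by blast
    then show ?thesis
      by (auto simp: ps_def)
  qed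
  moreover have "(i, j) \<in> lam \<longleftrightarrow> (i, j) \<in> young_diagram ps" for i j
  proof -
    have 1: "(i, j) \<in> lam \<longleftrightarrow> 1 \<le> j \<and> j \<le> card (R i)"
      using arg_cong[OF row[of i], of "\<lambda>A. j \<in> A"] unfolding R_def mem_Collect_eq atLeastAtMost_iff .
    have "(i, j) \<in> lam \<Longrightarrow> i \<in> {1..k}"
      using down[of i j i 1] pos[of i j] col by auto
    then show ?thesis
      using 1 by (auto simp: young_diagram_def ps_def)
  qed
  ultimately show ?L
    unfolding is_partition_def by (auto intro!: exI[of _ ps])
qed

section \<open>Ladders as level sets, and regularization\<close>

text \<open>For \<open>l = Suc m\<close> the ladder relation \<open>c - a = m * (b - d)\<close>
  rearranges to \<open>c + m * d = a + m * b\<close>. So this number labels the ladders, and no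
  signed subtraction is left.\<close>

definition lev :: "nat \<Rightarrow> position \<Rightarrow> nat" where
  "lev m x = fst x + m * snd x"

definition level_set :: "nat \<Rightarrow> nat \<Rightarrow> position set" where
  "level_set m n = {x. is_position x \<and> lev m x = n}"

lemma ladder_eq_level_set: "ladder (Suc m) x = level_set m (lev m x)"
proof -
  have "int c - int a = (int (Suc m) - 1) * (int b - int d) \<longleftrightarrow> c + m * d = a + m * b"
    for a b c d
  proof -
    have "int c - int a = (int (Suc m) - 1) * (int b - int d)
        \<longleftrightarrow> int (c + m * d) = int (a + m * b)"
      by (simp add: algebra_simps)
    then show ?thesis
      by (simp only: of_nat_eq_iff)
  qed
  then show ?thesis
    by (auto simp: ladder_def level_set_def lev_def)
qed

lemma finite_level_set: "0 < m \<Longrightarrow> finite (level_set m n)"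
proof (rule finite_subset)
  assume "0 < m"
  then have "b \<le> a + m * b" for a b :: nat
    by (simp add: trans_le_add2)
  then show "level_set m n \<subseteq> {..n} \<times> {..n}"
    by (auto simp: level_set_def lev_def)
qed auto

lemma inj_on_fst_level_set: "0 < m \<Longrightarrow> inj_on fst (level_set m n)"
  by (auto simp: inj_on_def level_set_def lev_def)

text \<open>The rank of an element, the number of elements with smaller \<open>f\<close>, is
  injective on \<open>A\<close>, so it takes each value below \<open>card A\<close> once. This shows
  that a set defined by a rank bound, as in \<open>regularization\<close>, has the intended
  size.\<close>

lemma card_lowest_ranks:
  fixes f :: "'a \<Rightarrow> nat"
  assumes "finite A" "inj_on f A" "k \<le> card A"
  shows "card {x \<in> A. card {y \<in> A. f y < f x} < k} = k"
proof -
  define r where "r x = card {y \<in> A. f y < f x}" for x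
  have r_less: "r x < r x'" if "x \<in> A" "x' \<in> A" "f x < f x'" for x x'
    unfolding r_def by (rule psubset_card_mono) (use assms that in auto)
  have inj: "inj_on r A"
  proof (rule inj_onI)
    fix x y assume *: "x \<in> A" "y \<in> A" "r x = r y"
    then have "f x = f y"
      using r_less[of x y] r_less[of y x] by (metis linorder_neqE_nat less_irrefl)
    then show "x = y"
      using assms(2) * by (auto dest: inj_onD)
  qed
  have "r x < card A" if "x \<in> A" for x
    unfolding r_def by (rule psubset_card_mono) (use assms that in auto)
  then have "r ` A = {..<card A}"
    using inj assms(1) by (intro card_subset_eq) (auto simp: card_image)
  moreover have "r ` {x \<in> A. r x < k} = r ` A \<inter> {..<k}"
    by auto
  ultimately have "r ` {x \<in> A. r x < k} = {..<k}"
    using assms(3) by auto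
  moreover have "inj_on r {x \<in> A. r x < k}"
    using inj by (rule inj_on_subset) auto
  ultimately have "card {x \<in> A. r x < k} = k"
    by (metis card_image card_lessThan)
  then show ?thesis
    by (simp add: r_def)
qed

lemma card_regularization_level:
  assumes "0 < m"
  shows "card (level_set m n \<inter> regularization (Suc m) lam) = card (level_set m n \<inter> lam)"
proof -
  let ?A = "level_set m n"
  have "?A \<inter> regularization (Suc m) lam
      = {x \<in> ?A. card {y \<in> ?A. fst y < fst x} < card (?A \<inter> lam)}"
    by (auto simp: regularization_def ladder_eq_level_set level_set_def)
  then show ?thesis
    using card_lowest_ranks[OF finite_level_set inj_on_fst_level_set, OF assms assms]
    by (simp add: card_mono finite_level_set assms)
qed

text \<open>Regularizing preserves the number of boxes on each ladder, and its definition refers to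
  the partition only through these numbers.\<close>

lemma regularization_eq_iff:
  assumes "0 < m"
  shows "regularization (Suc m) mu = regularization (Suc m) lam \<longleftrightarrow>
    (\<forall>n. card (level_set m n \<inter> mu) = card (level_set m n \<inter> lam))"
proof
  assume eq: "regularization (Suc m) mu = regularization (Suc m) lam"
  show "\<forall>n. card (level_set m n \<inter> mu) = card (level_set m n \<inter> lam)"
  proof
    fix n
    show "card (level_set m n \<inter> mu) = card (level_set m n \<inter> lam)"
      using card_regularization_level[OF assms, of n mu]
        card_regularization_level[OF assms, of n lam] unfolding eq by (rule trans[OF sym])
  qed
next
  assume "\<forall>n. card (level_set m n \<inter> mu) = card (level_set m n \<inter> lam)"
  then show "regularization (Suc m) mu = regularization (Suc m) lam"
    unfolding regularization_def ladder_eq_level_set by presburger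
qed

section \<open>Partitions encoded by the levels of their column ends\<close>

text \<open>
  Column \<open>b\<close> of \<open>diagram m s\<close> has height \<open>s b - m * b\<close>, so \<open>s b\<close> is the level of its lowest
  box; the value \<open>s 0\<close> is irrelevant.
\<close>

definition diagram :: "nat \<Rightarrow> (nat \<Rightarrow> nat) \<Rightarrow> position set" where
  "diagram m s = {(a, b). 1 \<le> a \<and> 1 \<le> b \<and> a + m * b \<le> s b}"

definition shape :: "nat \<Rightarrow> nat \<Rightarrow> (nat \<Rightarrow> nat) \<Rightarrow> bool" where
  "shape m N s \<longleftrightarrow> (\<forall>b\<ge>1. s (Suc b) \<le> s b + m) \<and> (\<forall>b>N. s b = m * b)"

lemma shape_step: "shape m N s \<Longrightarrow> 1 \<le> b \<Longrightarrow> s (Suc b) \<le> s b + m"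
  by (simp add: shape_def)

lemma shape_tail: "shape m N s \<Longrightarrow> N < b \<Longrightarrow> s b = m * b"
  by (simp add: shape_def)

lemma shape_extend: "shape m N s \<Longrightarrow> N \<le> N' \<Longrightarrow> shape m N' s"
  by (auto simp: shape_def)

lemma shape_steps:
  assumes "shape m N s" "1 \<le> b'" "b' \<le> b"
  shows "s b + m * b' \<le> s b' + m * b"
  using assms(3)
proof (induction rule: dec_induct)
  case (step n)
  then show ?case
    using shape_step[OF assms(1), of n] assms(2) by simp
qed simp

lemma shape_ge:
  assumes "shape m N s" "1 \<le> b"
  shows "m * b \<le> s b"
proof (cases "b \<le> N")
  case True
  then show ?thesis
    using shape_steps[OF assms, of "Suc N"] shape_tail[OF assms(1), of "Suc N"] by simp
qed (use assms in \<open>simp add: shape_tail\<close>)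

lemma diagram_column_le: "shape m N s \<Longrightarrow> (a, b) \<in> diagram m s \<Longrightarrow> b \<le> N"
  by (rule ccontr) (auto simp: diagram_def shape_tail)

lemma is_partition_diagram:
  assumes "shape m N s"
  shows "is_partition (diagram m s)"
  unfolding is_partition_iff_down_closed
proof (intro conjI allI impI)
  have "diagram m s \<subseteq> (\<Union>b\<in>{1..N}. {1..s b} \<times> {b})"
    using diagram_column_le[OF assms] by (force simp: diagram_def)
  then show "finite (diagram m s)"
    by (rule finite_subset) auto
  show "(a', b') \<in> diagram m s"
    if "(a, b) \<in> diagram m s" "1 \<le> a'" "a' \<le> a" "1 \<le> b'" "b' \<le> b" for a b a' b'
    using that shape_steps[OF assms, of b' b] by (auto simp: diagram_def)
qed (auto simp: diagram_def is_position_def)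

lemma is_partition_obtain_shape:
  assumes "is_partition lam"
  obtains N s where "shape m N s" "lam = diagram m s"
proof -
  note P = assms[unfolded is_partition_iff_down_closed]
  have pos: "1 \<le> a \<and> 1 \<le> b" if "(a, b) \<in> lam" for a b
    using P that by (force simp: is_position_def)
  have down: "(a', b') \<in> lam"
    if "(a, b) \<in> lam" "1 \<le> a'" "a' \<le> a" "1 \<le> b'" "b' \<le> b" for a b a' b'
    using P that by blast
  have finlam: "finite lam"
    using P by blast
  define C where "C b = {a. (a, b) \<in> lam}" for b
  have "C b \<subseteq> fst ` lam" for b
    by (force simp: C_def)
  then have fin: "finite (C b)" for b
    using finlam by (rule finite_subset[OF _ finite_imageI])
  have col: "C b = {1..card (C b)}" for b
  proof (rule initial_segment_eq)
    show "0 \<notin> C b"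
      using pos[of 0 b] by (auto simp: C_def)
    show "a' \<in> C b" if "a \<in> C b" "1 \<le> a'" "a' \<le> a" for a a'
      using that down[of a b a' b] pos[of a b] by (auto simp: C_def)
  qed (rule fin)
  obtain N where N: "\<forall>b\<in>snd ` lam. b \<le> N"
    using finlam finite_nat_set_iff_bounded_le[of "snd ` lam"] by auto
  define s where "s b = card (C b) + m * b" for b
  have "C (Suc b) \<subseteq> C b" if "1 \<le> b" for b
    using down[of _ "Suc b" _ b] pos that by (auto simp: C_def)
  then have "card (C (Suc b)) \<le> card (C b)" if "1 \<le> b" for b
    using that fin card_mono by blast
  moreover have "C b = {}" if "N < b" for b
    using N that by (force simp: C_def)
  ultimately have "shape m N s"
    by (auto simp: shape_def s_def)
  moreover have "(a, b) \<in> lam \<longleftrightarrow> (a, b) \<in> diagram m s" for a b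
  proof -
    have "(a, b) \<in> lam \<longleftrightarrow> 1 \<le> a \<and> a \<le> card (C b)"
      using arg_cong[OF col[of b], of "\<lambda>A. a \<in> A"] unfolding C_def mem_Collect_eq atLeastAtMost_iff .
    then show ?thesis
      using pos by (auto simp: diagram_def s_def)
  qed
  ultimately show thesis
    using that by (metis subrelI subset_antisym)
qed

section \<open>Counting values of a sequence and boxes on a level\<close>

definition count_below :: "(nat \<Rightarrow> nat) \<Rightarrow> nat \<Rightarrow> nat \<Rightarrow> nat" where
  "count_below s d v = card {i \<in> {1..d}. s i < v}"

lemma count_below_0 [simp]: "count_below s 0 v = 0"
  by (simp add: count_below_def)

lemma count_below_Suc: "count_below s (Suc d) v = count_below s d v + (if s (Suc d) < v then 1 else 0)"
proof -
  have "{i \<in> {1..Suc d}. s i < v} =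
      (if s (Suc d) < v then insert (Suc d) {i \<in> {1..d}. s i < v} else {i \<in> {1..d}. s i < v})"
    by (auto simp: le_Suc_eq)
  then show ?thesis
    by (simp add: count_below_def)
qed

lemma count_below_mono: "u \<le> v \<Longrightarrow> count_below s d u \<le> count_below s d v"
  unfolding count_below_def by (intro card_mono) auto

text \<open>Equal counts mean that no value lies in the interval from \<open>u\<close> up to but
  excluding \<open>v\<close>. In this form the presence of a value can be transferred between two
  sequences whose counts agree.\<close>

lemma count_below_eq_iff:
  assumes "u \<le> v"
  shows "count_below s d u = count_below s d v \<longleftrightarrow> (\<forall>i\<in>{1..d}. s i < v \<longrightarrow> s i < u)"
proof
  assume "count_below s d u = count_below s d v"
  then have "{i \<in> {1..d}. s i < u} = {i \<in> {1..d}. s i < v}"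
    unfolding count_below_def using assms by (intro card_subset_eq) auto
  then show "\<forall>i\<in>{1..d}. s i < v \<longrightarrow> s i < u"
    by blast
next
  assume "\<forall>i\<in>{1..d}. s i < v \<longrightarrow> s i < u"
  then have "{i \<in> {1..d}. s i < u} = {i \<in> {1..d}. s i < v}"
    using assms by auto
  then show "count_below s d u = count_below s d v"
    by (simp add: count_below_def)
qed

lemma count_below_split:
  assumes "d \<le> N"
  shows "count_below s N v = count_below s d v + card {i \<in> {d<..N}. s i < v}"
proof -
  have "{i \<in> {1..N}. s i < v} = {i \<in> {1..d}. s i < v} \<union> {i \<in> {d<..N}. s i < v}"
    using assms by auto
  then show ?thesis
    unfolding count_below_def by (simp add: card_Un_disjoint disjoint_iff)
qed

text \<open>Column \<open>b\<close> has a box on level \<open>n\<close>, and then only one, iff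
  \<open>m * b < n \<le> s b\<close>. Among the columns with \<open>m * b < n\<close> the others are
  those with \<open>s b < n\<close>. The cut at column \<open>d\<close> serves the dominance order,
  where the top rows of a ladder are its rightmost columns.\<close>

lemma card_level_diagram:
  assumes "shape m N s" "d \<le> N"
  shows "card {x \<in> level_set m n \<inter> diagram m s. d < snd x} + count_below s N n
    = card {b \<in> {d<..N}. m * b < n} + count_below s d n"
proof -
  let ?E = "{b \<in> {d<..N}. m * b < n \<and> n \<le> s b}"
  have "bij_betw snd {x \<in> level_set m n \<inter> diagram m s. d < snd x} ?E"
  proof (rule bij_betw_byWitness[where f' = "\<lambda>b. (n - m * b, b)"])
    show "snd ` {x \<in> level_set m n \<inter> diagram m s. d < snd x} \<subseteq> ?E"
      using diagram_column_le[OF assms(1)] by (force simp: level_set_def lev_def diagram_def)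
  qed (auto simp: level_set_def lev_def diagram_def is_position_def)
  then have "card {x \<in> level_set m n \<inter> diagram m s. d < snd x} = card ?E"
    by (rule bij_betw_same_card)
  moreover have "{b \<in> {d<..N}. m * b < n} = ?E \<union> {b \<in> {d<..N}. s b < n}"
  proof -
    have "m * b < n" if "d < b" "s b < n" for b
      using shape_ge[OF assms(1), of b] that by simp
    then show ?thesis by auto
  qed
  then have "card {b \<in> {d<..N}. m * b < n} = card ?E + card {b \<in> {d<..N}. s b < n}"
    by (simp add: card_Un_disjoint disjoint_iff)
  ultimately show ?thesis
    using count_below_split[OF assms(2), of s n] by simp
qed

lemma card_level_diagram_total:
  assumes "shape m N s"
  shows "card (level_set m n \<inter> diagram m s) + count_below s N n = card {b \<in> {0<..N}. m * b < n}"
proof -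
  have "level_set m n \<inter> diagram m s = {x \<in> level_set m n \<inter> diagram m s. 0 < snd x}"
    by (auto simp: diagram_def)
  then show ?thesis
    using card_level_diagram[OF assms, of 0 n] by simp
qed

lemma level_counts_eq_iff:
  assumes "shape m N s" "shape m N t"
  shows "card (level_set m n \<inter> diagram m s) = card (level_set m n \<inter> diagram m t)
    \<longleftrightarrow> count_below s N n = count_below t N n"
  using card_level_diagram_total[OF assms(1), of n] card_level_diagram_total[OF assms(2), of n]
  by linarith

section \<open>The sequence of the locked boxes\<close>

text \<open>
  The sequence \<open>q\<close> describes the locked boxes of \<open>diagram m s\<close>; \<open>lockseq m N g g\<close> says that
  \<open>g\<close> is greedy.
\<close>

definition lockseq :: "nat \<Rightarrow> nat \<Rightarrow> (nat \<Rightarrow> nat) \<Rightarrow> (nat \<Rightarrow> nat) \<Rightarrow> bool" where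
  "lockseq m N s q \<longleftrightarrow> (\<forall>b>N. q b = m * b) \<and>
    (\<forall>b\<in>{1..N}. q b \<in> s ` {1..b} \<and> q (Suc b) \<le> q b + m \<and>
      (\<forall>i\<in>{1..b}. q (Suc b) \<le> s i + m \<longrightarrow> q b \<le> s i))"

lemma lockseq_tail: "lockseq m N s q \<Longrightarrow> N < b \<Longrightarrow> q b = m * b"
  by (simp add: lockseq_def)

lemma lockseqD:
  assumes "lockseq m N s q" "1 \<le> b" "b \<le> N"
  shows "q b \<in> s ` {1..b}" "q (Suc b) \<le> q b + m"
    "\<And>i. 1 \<le> i \<Longrightarrow> i \<le> b \<Longrightarrow> q (Suc b) \<le> s i + m \<Longrightarrow> q b \<le> s i"
  using assms unfolding lockseq_def atLeastAtMost_iff Ball_def by blast+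

lemma lockseq_min:
  "lockseq m N s q \<Longrightarrow> b \<le> N \<Longrightarrow> 1 \<le> i \<Longrightarrow> i \<le> b \<Longrightarrow> q (Suc b) \<le> s i + m \<Longrightarrow> q b \<le> s i"
  using lockseqD(3) le_trans by blast

lemma lockseq_shape:
  assumes "lockseq m N s q"
  shows "shape m N q"
  unfolding shape_def
proof (intro conjI allI impI)
  fix b :: nat
  assume "1 \<le> b"
  then show "q (Suc b) \<le> q b + m"
    using lockseqD(2)[OF assms] lockseq_tail[OF assms, of b] lockseq_tail[OF assms, of "Suc b"]
    by (cases "b \<le> N") auto
qed (rule lockseq_tail[OF assms])

text \<open>From right to left, \<open>q (Suc b) \<le> s (Suc b) \<le> s b + m\<close> makes
  \<open>s b\<close> an admissible choice at \<open>b\<close>, and \<open>q b\<close> is the least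
  one.\<close>

lemma lockseq_le:
  assumes "lockseq m N s q" "shape m N s" "1 \<le> b"
  shows "q b \<le> s b"
proof (cases "b \<le> Suc N")
  case True
  then show ?thesis
    using assms(3)
  proof (induction rule: inc_induct)
    case base
    then show ?case
      using shape_tail[OF assms(2)] shape_tail[OF lockseq_shape[OF assms(1)]] by simp
  next
    case (step n)
    then show ?case
      using lockseq_min[OF assms(1), of n n] shape_step[OF assms(2), of n] by simp
  qed
next
  case False
  then show ?thesis
    using shape_tail[OF assms(2)] shape_tail[OF lockseq_shape[OF assms(1)]] by simp
qed

lemma exists_lockseq:
  assumes "shape m N s"
  shows "\<exists>q. lockseq m N s q"
proof -
  \<comment> \<open>The start value \<open>r\<close> is arbitrary for the induction. The bound
    \<open>r \<le> s (Suc n)\<close> guarantees that \<open>s n\<close> is an admissible candidate,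
    and the least candidate satisfies the same bound one column further left.\<close>
  have "\<exists>q. q (Suc n) = r \<and> (\<forall>b\<in>{1..n}. q b \<in> s ` {1..b} \<and> q (Suc b) \<le> q b + m \<and>
      (\<forall>i\<in>{1..b}. q (Suc b) \<le> s i + m \<longrightarrow> q b \<le> s i))"
    if "r \<le> s (Suc n)" for n r
    using that
  proof (induction n arbitrary: r)
    case 0
    then show ?case by (auto intro: exI[of _ "\<lambda>_. r"])
  next
    case (Suc n)
    let ?P = "{x \<in> s ` {1..Suc n}. r \<le> x + m}"
    have ne: "s (Suc n) \<in> ?P"
      using Suc.prems shape_step[OF assms, of "Suc n"] by auto
    have fin: "finite ?P" by simp
    define v where "v = Min ?P"
    have v: "v \<in> ?P" "\<And>x. x \<in> ?P \<Longrightarrow> v \<le> x"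
      unfolding v_def using Min_in[OF fin] Min_le[OF fin] ne by blast+
    obtain q where q: "q (Suc n) = v" "\<forall>b\<in>{1..n}. q b \<in> s ` {1..b} \<and> q (Suc b) \<le> q b + m \<and>
      (\<forall>i\<in>{1..b}. q (Suc b) \<le> s i + m \<longrightarrow> q b \<le> s i)"
      using Suc.IH[OF v(2)[OF ne]] by blast
    let ?q = "q(Suc (Suc n) := r)"
    have "?q b \<in> s ` {1..b} \<and> ?q (Suc b) \<le> ?q b + m \<and>
      (\<forall>i\<in>{1..b}. ?q (Suc b) \<le> s i + m \<longrightarrow> ?q b \<le> s i)" if "b \<in> {1..Suc n}" for b
    proof (cases "b = Suc n")
      case True
      then show ?thesis
        using v q(1) by auto
    next
      case False
      then show ?thesis
        using q(2) that by auto
    qed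
    then show ?case
      by (intro exI[of _ ?q]) simp
  qed
  from this[of "m * Suc N" N] obtain q where q: "q (Suc N) = m * Suc N"
    "\<forall>b\<in>{1..N}. q b \<in> s ` {1..b} \<and> q (Suc b) \<le> q b + m \<and>
      (\<forall>i\<in>{1..b}. q (Suc b) \<le> s i + m \<longrightarrow> q b \<le> s i)"
    using shape_tail[OF assms, of "Suc N"] by auto
  have "lockseq m N s (\<lambda>b. if b \<le> N then q b else m * b)"
    unfolding lockseq_def
  proof (intro conjI ballI)
    fix b assume "b \<in> {1..N}"
    moreover from this have "(if Suc b \<le> N then q (Suc b) else m * Suc b) = q (Suc b)"
      using q(1) by (auto simp: not_less_eq_eq le_antisym)
    ultimately show
      "(if b \<le> N then q b else m * b) \<in> s ` {1..b}"
      "(if Suc b \<le> N then q (Suc b) else m * Suc b) \<le> (if b \<le> N then q b else m * b) + m"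
      "\<And>i. i \<in> {1..b} \<Longrightarrow> (if Suc b \<le> N then q (Suc b) else m * Suc b) \<le> s i + m \<longrightarrow>
          (if b \<le> N then q b else m * b) \<le> s i"
      using q(2) by auto
  qed auto
  then show ?thesis by blast
qed

lemma diagram_mono: "(\<And>b. 1 \<le> b \<Longrightarrow> q b \<le> s b) \<Longrightarrow> diagram m q \<subseteq> diagram m s"
  unfolding diagram_def using le_trans by blast

lemma diagram_inj:
  assumes "shape m N s" "shape m N t" "diagram m s = diagram m t" "1 \<le> b"
  shows "s b = t b"
proof -
  have "t b \<le> s b" if "shape m N s" "shape m N t" "diagram m s = diagram m t" for s t
  proof (rule ccontr)
    assume "\<not> t b \<le> s b"
    then have "(t b - m * b, b) \<in> diagram m t" "(t b - m * b, b) \<notin> diagram m s"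
      using shape_ge[OF that(1) assms(4)] shape_ge[OF that(2) assms(4)] assms(4)
      by (auto simp: diagram_def)
    then show False
      using that(3) by simp
  qed
  from this[OF assms(1-3)] this[OF assms(2,1) assms(3)[symmetric]] show ?thesis
    by simp
qed

text \<open>The box just below the end of column \<open>b\<close> of \<open>q\<close> cannot be
  locked by rule (I): its ladder meets the position just below a column \<open>d < b\<close> with
  \<open>s d = q b\<close>. Conversely, a box of \<open>q\<close> either has a box of
  \<open>q\<close> to its right, and rule (II) applies, or any obstruction to rule (I) would be an
  admissible value smaller than \<open>q b\<close>.\<close>

lemma locked_diagram:
  assumes "0 < m" "shape m N s" "lockseq m N s q"
  shows "locked (Suc m) (diagram m s) = diagram m q"
proof -
  note shq = lockseq_shape[OF assms(3)]
  have sub: "diagram m q \<subseteq> diagram m s"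
    by (rule diagram_mono) (rule lockseq_le[OF assms(3,2)])
  have "(a, b) \<in> diagram m q" if "(a, b) \<in> locked (Suc m) (diagram m s)" for a b
    using that
  proof (induction rule: locked.induct)
    case (lock_column a b)
    then have ab: "1 \<le> a" "1 \<le> b" "b \<le> N" "a + m * b \<le> s b"
      using diagram_column_le[OF assms(2)] by (auto simp: diagram_def)
    show ?case
    proof (rule ccontr)
      assume "(a, b) \<notin> diagram m q"
      then have "q b < a + m * b"
        using ab by (auto simp: diagram_def)
      moreover have "a - 1 + m * b \<le> q b"
        using lock_column.IH shape_ge[OF shq ab(2)] by (auto simp: diagram_def)
      ultimately have qb: "Suc (q b) = a + m * b"
        using ab(1) by linarith
      obtain d where d: "d \<in> {1..b}" "q b = s d"
        using lockseqD(1)[OF assms(3) ab(2,3)] by blast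
      then have "d < b"
        using qb ab(4) by (metis Suc_n_not_le_n atLeastAtMost_iff le_neq_implies_less)
      \<comment> \<open>The position of column \<open>d\<close> on the ladder of
        \<open>(a, b)\<close>. Its level exceeds \<open>s d\<close> by one, so it is unoccupied
        while the position above it is a box.\<close>
      define c where "c = a + m * (b - d)"
      have c: "c + m * d = a + m * b" "a < c"
        using \<open>d < b\<close> assms(1) by (simp_all add: c_def flip: add_mult_distrib2)
      have "(c, d) \<in> ladder (Suc m) (a, b)"
        using c d(1) ab by (auto simp: ladder_eq_level_set level_set_def lev_def is_position_def)
      moreover have "(c, d) \<notin> diagram m s" "(c - 1, d) \<in> diagram m s"
        using c d qb ab by (auto simp: diagram_def)
      ultimately show False
        using lock_column.hyps(2) c(2) by fastforce
    qed
  next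
    case (lock_row a b d)
    then show ?case
      using shape_steps[OF shq, of d b] by (auto simp: diagram_def)
  qed
  moreover have "(a, b) \<in> locked (Suc m) (diagram m s)" if "(a, b) \<in> diagram m q" for a b
  proof -
    have "b \<le> Suc N"
      using diagram_column_le[OF shq that] by simp
    then show ?thesis
      using that
    proof (induction arbitrary: a rule: inc_induct)
      case base
      then show ?case
        using diagram_column_le[OF shq] by fastforce
    next
      case (step b)
      note right = step.IH
      show ?case
        using step.prems
      proof (induction a)
        case 0
        then show ?case by (simp add: diagram_def)
      next
        case (Suc a)
        show ?case
        proof (cases "(Suc a, Suc b) \<in> diagram m q")
          case True
          then show ?thesis
            using right sub Suc.prems by (auto intro: locked.lock_row)
        next
          case False
          have b: "1 \<le> b" "b \<le> N" and le: "Suc a + m * b \<le> q b"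
            using Suc.prems diagram_column_le[OF shq Suc.prems] by (auto simp: diagram_def)
          have less: "q (Suc b) < Suc a + m * Suc b"
            using False by (auto simp: diagram_def)
          show ?thesis
          proof (rule locked.lock_column)
            show "(Suc a, b) \<in> diagram m s"
              using Suc.prems sub by blast
            show "Suc a = 1 \<or> (Suc a - 1, b) \<in> locked (Suc m) (diagram m s)"
            proof (cases "a = 0")
              case False
              then have "(a, b) \<in> diagram m q"
                using Suc.prems by (auto simp: diagram_def)
              then show ?thesis
                using Suc.IH by simp
            qed simp
            have False if cd: "(c, d) \<in> ladder (Suc m) (Suc a, b)" "Suc a < c"
              "(c, d) \<notin> diagram m s" "(c - 1, d) \<in> diagram m s" for c d
            proof -
              have eq: "c + m * d = Suc a + m * b" "1 \<le> d"
                using cd(1) by (auto simp: ladder_eq_level_set level_set_def lev_def is_position_def)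
              then have "m * d < m * b"
                using cd(2) by linarith
              then have "d < b"
                by simp
              \<comment> \<open>The obstruction lies directly below column \<open>d\<close>, so
                \<open>s d\<close> is one less than the level of the ladder. As
                \<open>(Suc a, Suc b)\<close> is outside \<open>q\<close>, this value is within
                reach of \<open>q (Suc b)\<close>.\<close>
              have sd: "Suc (s d) = Suc a + m * b"
                using cd eq by (auto simp: diagram_def)
              then have "q b \<le> s d"
                using lockseq_min[OF assms(3) b(2) eq(2)] \<open>d < b\<close> less by simp
              then show False
                using sd le by simp
            qed
            then show "\<forall>(c, d)\<in>ladder (Suc m) (Suc a, b). Suc a < c \<and> (c, d) \<notin> diagram m s \<longrightarrow>
                (c - 1, d) \<notin> diagram m s"
              by blast
          qed
        qed
      qed
    qed
  qed
  ultimately show ?thesis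
    by auto
qed

section \<open>Existence of the greedy arrangement\<close>

lemma last_index_with:
  fixes e d :: nat
  assumes "e \<le> d" "P e"
  obtains j where "e \<le> j" "j \<le> d" "P j" "j < d \<Longrightarrow> \<not> P (Suc j)"
proof -
  have "\<exists>j. e \<le> j \<and> j \<le> d \<and> P j \<and> (j < d \<longrightarrow> \<not> P (Suc j))"
    using assms(1)
  proof (induction rule: dec_induct)
    case base
    then show ?case using assms(2) by auto
  next
    case (step d)
    show ?case
    proof (cases "P (Suc d)")
      case True
      then show ?thesis using step.hyps by (intro exI[of _ "Suc d"]) auto
    next
      case False
      then show ?thesis using step.IH by (metis le_SucI less_Suc_eq le_neq_implies_less)
    qed
  qed
  then show thesis using that by blast
qed

text \<open>
  The gap condition on \<open>P\<close> and \<open>r\<close> is equivalent to the existence of some admissible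
  arrangement, and unlike the latter it is visibly preserved by a greedy step.
\<close>

lemma exists_greedy_arrangement:
  fixes P :: "nat multiset"
  assumes "size P = n" "\<And>x. x \<in># P \<Longrightarrow> x < r \<Longrightarrow> \<exists>y\<in>insert r (set_mset P). x < y \<and> y \<le> x + m"
  shows "\<exists>g. g (Suc n) = r \<and> image_mset g (mset_set {1..n}) = P \<and>
    (\<forall>b\<in>{1..n}. g (Suc b) \<le> g b + m \<and> (\<forall>i\<in>{1..b}. g (Suc b) \<le> g i + m \<longrightarrow> g b \<le> g i))"
  using assms
proof (induction n arbitrary: P r)
  case 0
  then show ?case by (auto intro: exI[of _ "\<lambda>_. r"])
next
  case (Suc n)
  let ?V = "{x \<in> set_mset P. r \<le> x + m}"
  have "set_mset P \<noteq> {}"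
    using Suc.prems(1) by auto
  then obtain x where x: "x \<in># P" "\<And>y. y \<in># P \<Longrightarrow> y \<le> x"
    using Max_in[of "set_mset P"] Max_ge[of "set_mset P"] by blast
  \<comment> \<open>The largest remaining value is always admissible: if it is below
    \<open>r\<close>, its gap condition can only be witnessed by \<open>r\<close> itself.\<close>
  have "x \<in> ?V"
  proof (cases "x < r")
    case True
    then show ?thesis
      using Suc.prems(2)[OF x(1)] x by (auto simp: not_less[symmetric])
  qed (use x(1) in auto)
  moreover have fin: "finite ?V" by simp
  define v where "v = Min ?V"
  ultimately have v: "v \<in> ?V" "\<And>x. x \<in> ?V \<Longrightarrow> v \<le> x"
    unfolding v_def using Min_in[OF fin] Min_le[OF fin] by blast+
  define Q where "Q = P - {#v#}"
  have P: "P = add_mset v Q"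
    using v(1) by (simp add: Q_def)
  \<comment> \<open>A value below \<open>v\<close> is not admissible, so it is more than
    \<open>m\<close> below \<open>r\<close>. Its old witness is therefore not \<open>r\<close> but
    lies in \<open>P\<close>, hence is \<open>v\<close> or survives in \<open>Q\<close>.\<close>
  have gap: "\<exists>y\<in>insert v (set_mset Q). x < y \<and> y \<le> x + m" if "x \<in># Q" "x < v" for x
  proof -
    have "x \<in># P" "x + m < r"
      using that v(2)[of x] by (auto simp: P not_le[symmetric])
    then obtain y where "y \<in> insert r (set_mset P)" "x < y" "y \<le> x + m"
      using Suc.prems(2)[of x] by fastforce
    then show ?thesis
      using \<open>x + m < r\<close> by (auto simp: P)
  qed
  obtain g where g: "g (Suc n) = v" "image_mset g (mset_set {1..n}) = Q"
    "\<forall>b\<in>{1..n}. g (Suc b) \<le> g b + m \<and> (\<forall>i\<in>{1..b}. g (Suc b) \<le> g i + m \<longrightarrow> g b \<le> g i)"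
    using Suc.IH[OF _ gap] Suc.prems(1) by (auto simp: P)
  have img: "image_mset g (mset_set {1..Suc n}) = P"
    using g(1,2) by (simp add: P atLeastAtMostSuc_conv)
  let ?g = "g(Suc (Suc n) := r)"
  have "image_mset ?g (mset_set {1..Suc n}) = P"
    unfolding img[symmetric] by (rule image_mset_cong) auto
  moreover have "?g (Suc b) \<le> ?g b + m \<and> (\<forall>i\<in>{1..b}. ?g (Suc b) \<le> ?g i + m \<longrightarrow> ?g b \<le> ?g i)"
    if b: "b \<in> {1..Suc n}" for b
  proof (cases "b = Suc n")
    case True
    have "g i \<in># P" if "i \<in> {1..Suc n}" for i
      unfolding img[symmetric] using that by (simp only: set_image_mset finite_set_mset_mset_set finite_atLeastAtMost imageI)
    then show ?thesis
      using True v g(1) by auto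
  next
    case False
    then have "b \<in> {1..n}" using b by auto
    then show ?thesis
      using bspec[OF g(3)] by auto
  qed
  ultimately show ?case
    by (intro exI[of _ ?g] conjI ballI) (simp, assumption, blast+)
qed

lemma count_below_eq_size: "count_below s n v = size (filter_mset (\<lambda>x. x < v) (image_mset s (mset_set {1..n})))"
  by (simp add: count_below_def filter_mset_image_mset)

lemma exists_greedy:
  assumes "shape m N s"
  obtains g where "lockseq m N g g" "\<And>v. count_below g N v = count_below s N v"
proof -
  let ?P = "image_mset s (mset_set {1..N})" and ?r = "m * Suc N"
  have "\<exists>y\<in>insert ?r (set_mset ?P). x < y \<and> y \<le> x + m" if "x \<in># ?P" "x < ?r" for x
  proof -
    obtain i where i: "i \<in> {1..N}" "x = s i"
      using \<open>x \<in># ?P\<close> by auto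
    \<comment> \<open>At the last index whose value is at most \<open>x\<close>, the sequence climbs
      past \<open>x\<close> in the next column, by a step of at most \<open>m\<close>. This supplies
      the witness for the gap condition.\<close>
    obtain j where j: "i \<le> j" "j \<le> N" "s j \<le> x" "j < N \<Longrightarrow> \<not> s (Suc j) \<le> x"
      using last_index_with[of i N "\<lambda>j. s j \<le> x"] i by auto
    have "x < s (Suc j)"
    proof (cases "j < N")
      case True
      then show ?thesis
        using j(4) by simp
    next
      case False
      then show ?thesis
        using shape_tail[OF assms, of "Suc j"] that(2) j(2) by simp
    qed
    moreover have "s (Suc j) \<le> x + m"
      using shape_step[OF assms, of j] j i(1) by auto
    moreover have "s (Suc j) \<in> insert ?r (set_mset ?P)"
    proof (cases "Suc j \<le> N")
      case False
      then have "Suc j = Suc N"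
        using j(2) by simp
      then show ?thesis
        using shape_tail[OF assms, of "Suc N"] by simp
    qed auto
    ultimately show ?thesis by blast
  qed
  from exists_greedy_arrangement[OF _ this, of N] obtain g where
    g: "g (Suc N) = ?r" "image_mset g (mset_set {1..N}) = ?P"
    "\<forall>b\<in>{1..N}. g (Suc b) \<le> g b + m \<and> (\<forall>i\<in>{1..b}. g (Suc b) \<le> g i + m \<longrightarrow> g b \<le> g i)"
    by auto
  \<comment> \<open>The arrangement is controlled only up to \<open>Suc N\<close>; beyond
    \<open>N\<close> the empty columns are filled in. The two agree at \<open>Suc N\<close>, where
    the value is \<open>m * Suc N\<close>.\<close>
  define g' where "g' b = (if b \<le> N then g b else m * b)" for b
  have g'_eq: "g' b = g b" if "b \<le> Suc N" for b
    using that g(1) by (cases "b = Suc N") (auto simp: g'_def)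
  have "lockseq m N g' g'"
    unfolding lockseq_def
  proof (intro conjI ballI)
    fix b assume b: "b \<in> {1..N}"
    then show "g' b \<in> g' ` {1..b}" by auto
    show "g' (Suc b) \<le> g' b + m"
      using bspec[OF g(3) b] b by (simp add: g'_eq)
    show "g' (Suc b) \<le> g' i + m \<longrightarrow> g' b \<le> g' i" if "i \<in> {1..b}" for i
      using bspec[OF g(3) b] b that by (simp add: g'_eq)
  qed (simp add: g'_def)
  moreover have "image_mset g' (mset_set {1..N}) = image_mset g (mset_set {1..N})"
    by (rule image_mset_cong) (simp add: g'_eq)
  then have "count_below g' N v = count_below s N v" for v
    by (simp only: count_below_eq_size g(2))
  ultimately show thesis
    using that by blast
qed

section \<open>Extremality and uniqueness of the greedy arrangement\<close>

text \<open>
  A smaller value that is still available at step \<open>d\<close> was out of reach at every earlier step.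
\<close>

lemma greedy_skip:
  assumes "lockseq m N g g" "d \<le> N" "1 \<le> i" "i \<le> d" "g i < g d" "d < j" "j \<le> Suc N"
  shows "g i + m < g j"
proof -
  have "Suc d \<le> j" using assms(6) by simp
  then show ?thesis
    using assms(7)
  proof (induction rule: dec_induct)
    case base
    show ?case
      using lockseq_min[OF assms(1-4)] assms(5) by linarith
  next
    case (step j)
    then have "g i < g j"
      by linarith
    then show ?case
      using lockseq_min[OF assms(1), of j i] step assms(3,4) by linarith
  qed
qed

lemma count_below_eq_iff_tail:
  assumes "d \<le> N"
  shows "count_below s d v = count_below s N v \<longleftrightarrow> (\<forall>i\<in>{d<..N}. v \<le> s i)"
  unfolding count_below_split[OF assms] by (auto simp: not_less)

lemma count_below_greedy_le:
  assumes g: "lockseq m N g g" and s: "shape m N s" and eq: "\<And>v. count_below g N v = count_below s N v"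
    and "d \<le> N"
  shows "count_below g d v \<le> count_below s d v"
  using \<open>d \<le> N\<close>
proof (induction arbitrary: v rule: inc_induct)
  case base
  then show ?case by (simp add: eq)
next
  case (step n)
  note IH = step.IH
  have n: "Suc n \<le> N"
    using step.hyps by simp
  show ?case
  proof (rule ccontr)
    assume "\<not> count_below g n v \<le> count_below s n v"
    then have less: "count_below s n v < count_below g n v" by simp
    have gv: "v \<le> g (Suc n)"
      using IH[of v] less by (auto simp: count_below_Suc not_less split: if_splits)
    have sv: "s (Suc n) < v"
      using IH[of v] less by (auto simp: count_below_Suc split: if_splits)
    let ?I = "g ` {i \<in> {1..n}. g i < v}"
    have "?I \<noteq> {}"
    proof
      assume "?I = {}"
      then have "count_below g n v = 0"
        unfolding count_below_def by (metis card.empty image_is_empty)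
      then show False
        using less by simp
    qed
    then have "Max ?I \<in> ?I"
      by (intro Max_in) auto
    then obtain e where e: "e \<in> {1..n}" "g e < v" "Max ?I = g e"
      by auto
    have max: "g i \<le> g e" if "i \<in> {1..n}" "g i < v" for i
      unfolding e(3)[symmetric] using that by (intro Max_ge) auto
    let ?X = "g e"
    have up: "?X + m < g j" if "Suc n < j" "j \<le> Suc N" for j
      using greedy_skip[OF g n, of e j] e gv that by simp
    \<comment> \<open>\<open>g\<close> has skipped \<open>X\<close>, so all its values at most
      \<open>X + m\<close> are still among the first \<open>Suc n\<close>. By the induction
      hypothesis the same holds for \<open>s\<close>.\<close>
    have "count_below g (Suc n) (Suc (?X + m)) = count_below g N (Suc (?X + m))"
      unfolding count_below_eq_iff_tail[OF n] using up by (auto simp: Suc_le_eq)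
    then have "count_below s N (Suc (?X + m)) \<le> count_below s (Suc n) (Suc (?X + m))"
      using IH[of "Suc (?X + m)"] eq by simp
    then have "count_below s (Suc n) (Suc (?X + m)) = count_below s N (Suc (?X + m))"
      using count_below_split[OF n, of s] by simp
    then have s_up: "\<forall>j\<in>{Suc n<..N}. ?X + m < s j"
      unfolding count_below_eq_iff_tail[OF n] by (simp add: Suc_le_eq)
    \<comment> \<open>For \<open>Suc n = N\<close> the next column lies in the common tail of
      \<open>g\<close> and \<open>s\<close>.\<close>
    have "?X + m < s (Suc (Suc n))"
    proof (cases "Suc n = N")
      case True
      then show ?thesis
        using up[of "Suc N"] shape_tail[OF s, of "Suc N"] lockseq_tail[OF g, of "Suc N"] by simp
    qed (use s_up n in auto)
    then have "?X < s (Suc n)"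
      using shape_step[OF s, of "Suc n"] by simp
    \<comment> \<open>By the choice of \<open>X\<close>, \<open>g\<close> has no remaining value
      strictly between \<open>X\<close> and \<open>v\<close>. Comparing counts excludes such values
      for \<open>s\<close> too.\<close>
    moreover have "count_below g (Suc n) (Suc ?X) = count_below g (Suc n) v"
    proof (subst count_below_eq_iff)
      show "\<forall>i\<in>{1..Suc n}. g i < v \<longrightarrow> g i < Suc (g e)"
        using max gv by (metis atLeastAtMost_iff le_Suc_eq le_imp_less_Suc linorder_not_le)
    qed (use e(2) in auto)
    then have "count_below s (Suc n) v \<le> count_below s (Suc n) (Suc ?X)"
      using IH[of "Suc ?X"] less sv gv by (simp add: count_below_Suc[of _ n v])
    then have "count_below s (Suc n) (Suc ?X) = count_below s (Suc n) v"
      using count_below_mono[of "Suc ?X" v s "Suc n"] e(2) by simp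
    then have "s (Suc n) < Suc ?X"
      using sv e(2) by (subst (asm) count_below_eq_iff) auto
    ultimately show False by simp
  qed
qed

lemma eq_if_cnt_eq:
  assumes "\<And>d v. d \<le> N \<Longrightarrow> count_below s d v = count_below t d v" "1 \<le> b" "b \<le> N"
  shows "s b = t b"
proof -
  obtain n where n: "b = Suc n"
    using assms(2) by (cases b) auto
  have "s b < v \<longleftrightarrow> t b < v" for v
    using assms(1)[of b v] assms(1)[of n v] assms(3) by (auto simp: n count_below_Suc split: if_splits)
  from this[of "s b"] this[of "t b"] show ?thesis by simp
qed

text \<open>Each arrangement is extremal against the other, so all counts coincide, and these
  determine the values one by one.\<close>

lemma greedy_unique:
  assumes "lockseq m N g g" "lockseq m N h h" "\<And>v. count_below g N v = count_below h N v" "1 \<le> b"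
  shows "g b = h b"
proof (cases "b \<le> N")
  case True
  have "count_below g d v = count_below h d v" if "d \<le> N" for d v
    using count_below_greedy_le[OF assms(1) lockseq_shape[OF assms(2)] assms(3) that, of v]
      count_below_greedy_le[OF assms(2) lockseq_shape[OF assms(1)] assms(3)[symmetric] that, of v]
    by simp
  then show ?thesis
    using eq_if_cnt_eq True assms(4) by blast
next
  case False
  then show ?thesis
    using lockseq_tail[OF assms(1)] lockseq_tail[OF assms(2)] by simp
qed

section \<open>The locked sequence compared with the greedy arrangement\<close>

text \<open>
  The second conjunct carries the induction: the values below \<open>q (Suc d)\<close> have been used
  equally often by \<open>g\<close> and \<open>s\<close>.
\<close>

lemma lockseq_greedy:
  assumes s: "shape m N s" and q: "lockseq m N s q" and g: "lockseq m N g g"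
    and eq: "\<And>v. count_below g N v = count_below s N v" and "d \<le> N"
  shows "q (Suc d) \<le> g (Suc d) \<and> (\<forall>v\<le>q (Suc d). count_below g d v = count_below s d v)"
  using \<open>d \<le> N\<close>
proof (induction rule: inc_induct)
  case base
  then show ?case
    using lockseq_tail[OF q, of "Suc N"] lockseq_tail[OF g, of "Suc N"] eq by simp
next
  case (step n)
  have n: "1 \<le> Suc n" "Suc n \<le> N"
    using step.hyps by auto
  let ?d = "Suc n"
  \<comment> \<open>The least value from which \<open>q (Suc ?d)\<close> can be reached; the
    truncated subtraction is harmless because values are natural numbers.\<close>
  let ?w = "q (Suc ?d) - m"
  have agree: "count_below g ?d v = count_below s ?d v" if "v \<le> q (Suc ?d)" for v
    using step.IH that by blast
  have no_s: "s i < ?w" if "i \<in> {1..?d}" "s i < q ?d" for i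
    using lockseqD(3)[OF q n, of i] that by fastforce
  \<comment> \<open>By minimality of \<open>q ?d\<close>, \<open>s\<close> has no value from
    \<open>?w\<close> up to \<open>q ?d\<close>, so its counts are constant there. Those of
    \<open>g\<close> agree at \<open>?w\<close> and are bounded by those of \<open>s\<close>, hence
    are constant as well.\<close>
  have below: "count_below g ?d v = count_below s ?d v \<and> count_below g ?d ?w = count_below g ?d v"
    if "?w \<le> v" "v \<le> q ?d" for v
  proof -
    have "count_below s ?d ?w = count_below s ?d v"
      using that no_s by (subst count_below_eq_iff) auto
    then show ?thesis
      using agree[of ?w] count_below_mono[OF that(1), of g ?d] count_below_greedy_le[OF g s eq n(2), of v] by simp
  qed
  have "?w \<le> q ?d"
    using lockseqD(2)[OF q n] by simp
  have qg: "q ?d \<le> g ?d"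
  proof (rule ccontr)
    assume "\<not> q ?d \<le> g ?d"
    moreover have "count_below g ?d ?w = count_below g ?d (q ?d)"
      using below[of "q ?d"] \<open>?w \<le> q ?d\<close> by simp
    ultimately have "g ?d < ?w"
      unfolding count_below_eq_iff[OF \<open>?w \<le> q ?d\<close>] by auto
    then show False
      using lockseqD(2)[OF g n] step.IH by auto
  qed
  moreover have "count_below g n v = count_below s n v" if "v \<le> q ?d" for v
  proof -
    have "count_below g ?d v = count_below s ?d v"
      using that below[of v] agree[of v] by (cases "?w \<le> v") auto
    moreover have "v \<le> s ?d"
      using lockseq_le[OF q s n(1)] that by simp
    ultimately show ?thesis
      using that qg by (simp add: count_below_Suc)
  qed
  ultimately show ?case by blast
qed

text \<open>This controls which boxes of the greedy diagram are unlocked: a column of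
  \<open>g\<close> with a lower end level somewhere to its left is entirely locked. Skipping
  persists to the right, so the induction from the right yields
  \<open>q (Suc d) = g (Suc d)\<close>, and below this value the remaining counts of
  \<open>g\<close> and \<open>s\<close> agree.\<close>

lemma greedy_eq_lockseq_if_skip:
  assumes s: "shape m N s" and q: "lockseq m N s q" and g: "lockseq m N g g"
    and eq: "\<And>v. count_below g N v = count_below s N v"
    and "d \<le> Suc N" "1 \<le> e" "e < d" "g e < g d"
  shows "q d = g d"
  using assms(5,7,8)
proof (induction rule: inc_induct)
  case base
  then show ?case
    using lockseq_tail[OF q, of "Suc N"] lockseq_tail[OF g, of "Suc N"] by simp
next
  case (step d)
  have d: "1 \<le> d" "d \<le> N"
    using step.hyps step.prems by auto
  have skip: "g e + m < g (Suc d)"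
    using greedy_skip[OF g d(2) assms(6), of "Suc d"] step.prems d by simp
  then have q1: "q (Suc d) = g (Suc d)"
    using step.IH step.prems by simp
  note lg = lockseq_greedy[OF s q g eq, of d, unfolded q1]
  have agree: "count_below g d v = count_below s d v" if "v \<le> g (Suc d)" for v
    using lg d that by blast
  let ?w = "g (Suc d) - m"
  \<comment> \<open>Walking right from \<open>e\<close>, \<open>g\<close> must climb to
    \<open>g (Suc d)\<close> by steps of at most \<open>m\<close>. So some remaining value of
    \<open>g\<close> lies below \<open>g (Suc d)\<close> but within reach of it, and by the counts
    \<open>s\<close> has one too.\<close>
  obtain j where j: "e \<le> j" "j \<le> d" "g j < g (Suc d)" "j < d \<Longrightarrow> \<not> g (Suc j) < g (Suc d)"
    using last_index_with[of e d "\<lambda>j. g j < g (Suc d)"] skip step.prems by auto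
  have "1 \<le> j"
    using j(1) assms(6) by simp
  have "g (Suc d) \<le> g (Suc j)"
    using j(2,4) by (cases "j = d") auto
  then have "?w \<le> g j"
    using lockseqD(2)[OF g \<open>1 \<le> j\<close>] j d by simp
  then have "count_below g d ?w \<noteq> count_below g d (g (Suc d))"
    using j \<open>1 \<le> j\<close> by (subst count_below_eq_iff) (auto simp: not_less)
  then have "count_below s d ?w \<noteq> count_below s d (g (Suc d))"
    using agree by simp
  then obtain i where "i \<in> {1..d}" "s i < g (Suc d)" "\<not> s i < ?w"
    by (subst (asm) count_below_eq_iff) auto
  moreover from this have "q (Suc d) \<le> s i + m"
    using q1 by linarith
  ultimately have q_less: "q d < g (Suc d)"
    using lockseqD(3)[OF q d, of i] by fastforce
  obtain k where k: "k \<in> {1..d}" "q d = s k"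
    using lockseqD(1)[OF q d] by blast
  then have "count_below s d (q d) \<noteq> count_below s d (Suc (q d))"
    by (subst count_below_eq_iff) auto
  then have "count_below g d (q d) \<noteq> count_below g d (Suc (q d))"
    using agree q_less by simp
  \<comment> \<open>The value \<open>q d\<close> itself also remains available to \<open>g\<close>.
    It is admissible there, so greediness gives \<open>g d \<le> q d\<close>.\<close>
  then obtain i where i: "i \<in> {1..d}" "g i = q d"
    by (subst (asm) count_below_eq_iff) (auto simp: less_Suc_eq)
  have "g d \<le> g i"
    using lockseqD(3)[OF g d, of i] lockseqD(2)[OF q d] i q1 by simp
  moreover have "q d \<le> g d"
    using lockseq_greedy[OF s q g eq, of "d - 1"] d by simp
  ultimately show ?case
    using i by simp
qed

text \<open>Allows comparison with partitions having more columns. Past \<open>N\<close> all columns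
  are empty, and admissibility of \<open>g i\<close> after \<open>m * Suc b\<close> already says
  \<open>m * b \<le> g i\<close>.\<close>

lemma lockseq_extend:
  assumes "lockseq m N g g" "N \<le> M"
  shows "lockseq m M g g"
  unfolding lockseq_def
proof (intro conjI ballI impI allI)
  fix b assume b: "b \<in> {1..M}"
  then show "g b \<in> g ` {1..b}" by auto
  show "g (Suc b) \<le> g b + m"
    using shape_step[OF lockseq_shape[OF assms(1)]] b by simp
  show "g b \<le> g i" if i: "i \<in> {1..b}" "g (Suc b) \<le> g i + m" for i
  proof (cases "b \<le> N")
    case True
    then show ?thesis
      using lockseq_min[OF assms(1), of b i] i by simp
  next
    case False
    then show ?thesis
      using lockseq_tail[OF assms(1), of b] lockseq_tail[OF assms(1), of "Suc b"] i(2) by simp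
  qed
qed (use lockseq_tail[OF assms(1)] assms(2) in simp)

text \<open>The diagram of \<open>g\<close> contains the locked boxes and has the right number of
  boxes on every ladder. It remains to see that its other boxes fill the lowest free
  positions.\<close>

lemma lowering_diagram:
  assumes m: "0 < m" and s: "shape m N s" and g: "lockseq m N g g"
    and eq: "\<And>v. count_below g N v = count_below s N v"
  shows "lowering (Suc m) (diagram m s) = diagram m g"
proof -
  obtain q where q: "lockseq m N s q"
    using exists_lockseq[OF s] by blast
  define K where "K = diagram m q"
  define G where "G = diagram m g"
  let ?L = "level_set m"
  note gs = lockseq_shape[OF g]
  have lock: "locked (Suc m) (diagram m s) = K"
    unfolding K_def by (rule locked_diagram[OF m s q])
  have K_sub: "K \<subseteq> diagram m s"
    unfolding K_def by (rule diagram_mono) (rule lockseq_le[OF q s])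
  have "q b \<le> g b" if "1 \<le> b" for b
  proof (cases "b \<le> Suc N")
    case True
    then show ?thesis
      using lockseq_greedy[OF s q g eq, of "b - 1"] that by simp
  next
    case False
    then show ?thesis
      using lockseq_tail[OF q, of b] lockseq_tail[OF g, of b] by simp
  qed
  then have K_G: "K \<subseteq> G"
    unfolding K_def G_def by (rule diagram_mono)
  have card_diff: "card (?L n \<inter> (A - K)) = card (?L n \<inter> A) - card (?L n \<inter> K)" if "K \<subseteq> A" for A n
  proof -
    have "?L n \<inter> (A - K) = (?L n \<inter> A) - (?L n \<inter> K)" by blast
    moreover have "?L n \<inter> K \<subseteq> ?L n \<inter> A"
      using that by blast
    ultimately show ?thesis
      using card_Diff_subset[of "?L n \<inter> K" "?L n \<inter> A"] finite_level_set[OF m] by simp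
  qed
  have "card (?L n \<inter> G) = card (?L n \<inter> diagram m s)" for n
    unfolding G_def using level_counts_eq_iff[OF gs s] eq by blast
  then have card_unlocked: "card (?L n \<inter> (diagram m s - K)) = card (?L n \<inter> (G - K))" for n
    by (simp add: card_diff K_sub K_G)
  have down: "y \<in> G" if "x \<in> G" "x \<notin> K" "x \<in> ?L n" "y \<in> ?L n" "fst x < fst y" for x y n
  proof (rule ccontr)
    assume "y \<notin> G"
    obtain c d c' d' where xy: "x = (c, d)" "y = (c', d')"
      by (cases x, cases y)
    have L: "c + m * d = n" "c' + m * d' = n" "1 \<le> d'" "1 \<le> c'" "c < c'"
      using that xy by (auto simp: level_set_def lev_def is_position_def)
    then have "m * d' < m * d" by linarith
    then have "d' < d" by simp
    moreover have "d \<le> Suc N"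
      using diagram_column_le[OF gs, of c d] that(1) by (simp add: xy G_def)
    moreover have "g d' < n" "n \<le> g d" "q d < n"
      using \<open>y \<notin> G\<close> that(1,2) L by (auto simp: xy G_def K_def diagram_def)
    \<comment> \<open>A position below \<open>x\<close> missing from \<open>G\<close> gives a column
      \<open>d' < d\<close> with \<open>g d' < g d\<close>, hence \<open>q d = g d\<close>; then
      \<open>x\<close> would be locked.\<close>
    ultimately show False
      using greedy_eq_lockseq_if_skip[OF s q g eq, of d d'] L(3) by simp
  qed
  \<comment> \<open>If \<open>x\<close> is in \<open>G\<close>, all free positions below it are
    unlocked boxes of \<open>G\<close>, and \<open>x\<close> is a further one. If not, all unlocked
    boxes of \<open>G\<close> on the ladder lie below \<open>x\<close>.\<close>
  have "x \<in> G \<longleftrightarrow> card {y \<in> ?L n. fst x < fst y \<and> y \<notin> K} < card (?L n \<inter> (G - K))"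
    (is "_ \<longleftrightarrow> card ?B < card ?U") if x: "x \<in> ?L n" "x \<notin> K" for x n
  proof
    assume "x \<in> G"
    then have "?B \<subseteq> ?U" "x \<in> ?U" "x \<notin> ?B"
      using down[OF \<open>x \<in> G\<close> x(2,1)] x by auto
    then show "card ?B < card ?U"
      by (intro psubset_card_mono) (auto simp: finite_level_set[OF m])
  next
    assume *: "card ?B < card ?U"
    show "x \<in> G"
    proof (rule ccontr)
      assume "x \<notin> G"
      have "?U \<subseteq> ?B"
      proof
        fix y assume y: "y \<in> ?U"
        then have "fst y \<noteq> fst x"
          using inj_onD[OF inj_on_fst_level_set[OF m], of y x] x(1) \<open>x \<notin> G\<close> by auto
        moreover have "\<not> fst y < fst x"
          using down[of y n x] y x(1) \<open>x \<notin> G\<close> by auto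
        ultimately show "y \<in> ?B"
          using y by auto
      qed
      then have "card ?U \<le> card ?B"
        by (intro card_mono) (auto simp: finite_level_set[OF m])
      then show False
        using * by simp
    qed
  qed
  note G_iff = this
  have pos_G: "is_position x" if "x \<in> G" for x
    using that by (auto simp: G_def diagram_def is_position_def)
  have "x \<in> lowering (Suc m) (diagram m s) \<longleftrightarrow> x \<in> G" for x
  proof (cases "x \<in> K \<or> \<not> is_position x")
    case True
    then show ?thesis
      using K_G pos_G[of x] by (auto simp: lowering_def lock)
  next
    case False
    then have "x \<in> ?L (lev m x)"
      by (simp add: level_set_def)
    then show ?thesis
      using G_iff[of x "lev m x"] False
      by (simp add: lowering_def lock ladder_eq_level_set card_unlocked)
  qed
  then show ?thesis
    by (auto simp: G_def)
qed

section \<open>Dominance order\<close>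

lemma sum_part_eq_card:
  assumes "is_partition lam"
  shows "(\<Sum>j = 1..i. part lam j) = card {x \<in> lam. fst x \<le> i}"
proof -
  note P = assms[unfolded is_partition_iff_down_closed]
  have "finite {k. (j, k) \<in> lam}" for j
    by (rule finite_subset[OF _ finite_imageI[of lam snd]]) (use P in force)+
  moreover have "{x \<in> lam. fst x \<le> i} = Sigma {1..i} (\<lambda>j. {k. (j, k) \<in> lam})"
    using P by (auto simp: is_position_def)
  moreover have "(\<Sum>j = 1..i. part lam j) = (\<Sum>j = 1..i. card {k. (j, k) \<in> lam})"
    by (rule sum.cong) (simp_all add: Defs.part_def)
  ultimately show ?thesis
    by simp
qed

lemma card_eq_sum_levels:
  assumes "finite A" "finite T" "lev m ` A \<subseteq> T"
  shows "card A = (\<Sum>n\<in>T. card {x \<in> A. lev m x = n})"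
  using sum.group[OF assms, of "\<lambda>_. 1 :: nat"] by simp

text \<open>The boxes in the first \<open>i\<close> rows are counted ladder by ladder. On one ladder
  these rows are the columns beyond some \<open>d\<close>, where \<open>card_level_diagram\<close>
  turns the claim into \<open>count_below_greedy_le\<close>.\<close>

lemma dominance_le_greedy:
  assumes m: "0 < m" and s: "shape m N s" and g: "lockseq m N g g"
    and eq: "\<And>v. count_below g N v = count_below s N v"
  shows "dominance_le (diagram m g) (diagram m s)"
proof -
  let ?G = "diagram m g" and ?S = "diagram m s"
  note gs = lockseq_shape[OF g]
  have part: "is_partition ?G" "is_partition ?S"
    using is_partition_diagram gs s by blast+
  then have fin: "finite ?G" "finite ?S"
    by (simp_all add: is_partition_iff_down_closed)
  define T where "T = lev m ` (?G \<union> ?S)"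
  have "finite T"
    using fin by (simp add: T_def)
  have level: "{x \<in> {x \<in> diagram m t. Q x}. lev m x = n} = {x \<in> level_set m n \<inter> diagram m t. Q x}"
    for n t Q
    by (auto simp: level_set_def diagram_def is_position_def)
  have sum_levels: "card {x \<in> diagram m t. Q x} = (\<Sum>n\<in>T. card {x \<in> level_set m n \<inter> diagram m t. Q x})"
    if "t = g \<or> t = s" for t Q
  proof -
    have "finite {x \<in> diagram m t. Q x}" "lev m ` {x \<in> diagram m t. Q x} \<subseteq> T"
      using that fin by (auto simp: T_def)
    from card_eq_sum_levels[OF this(1) \<open>finite T\<close> this(2)] show ?thesis
      by (simp only: level)
  qed
  have "card (diagram m t) = (\<Sum>n\<in>T. card (level_set m n \<inter> diagram m t))"
    if "t = g \<or> t = s" for t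
    using sum_levels[OF that, of "\<lambda>_. True"] by (simp only: simp_thms Collect_mem_eq)
  moreover have "card (level_set m n \<inter> ?G) = card (level_set m n \<inter> ?S)" for n
    using level_counts_eq_iff[OF gs s] eq by blast
  ultimately have "card ?G = card ?S"
    by simp
  moreover have "card {x \<in> level_set m n \<inter> ?G. fst x \<le> i} \<le> card {x \<in> level_set m n \<inter> ?S. fst x \<le> i}"
    for n i
  proof -
    \<comment> \<open>Row \<open>n - m * b\<close> is at most \<open>i\<close> iff
      \<open>m * b\<close> exceeds \<open>n - i - 1\<close>. For \<open>i \<ge> n\<close> truncation
      gives \<open>d = 0\<close>, and rightly every position of the level qualifies.\<close>
    define d where "d = (n - i - 1) div m"
    have "fst x \<le> i \<longleftrightarrow> d < snd x" if "x \<in> level_set m n" for x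
    proof -
      have x: "fst x + m * snd x = n" "1 \<le> snd x"
        using that by (auto simp: level_set_def lev_def is_position_def)
      show ?thesis
      proof (cases "i < n")
        case True
        have "snd x \<le> d \<longleftrightarrow> m * snd x \<le> n - i - 1"
          unfolding d_def by (simp add: less_eq_div_iff_mult_less_eq[OF m] mult.commute)
        then show ?thesis
          using x True by linarith
      qed (use x in \<open>simp add: d_def\<close>)
    qed
    then have rows: "{x \<in> level_set m n \<inter> A. fst x \<le> i} = {x \<in> level_set m n \<inter> A. d < snd x}" for A
      by blast
    show ?thesis
    proof (cases "d \<le> N")
      case True
      then show ?thesis
        unfolding rows using card_level_diagram[OF gs True, of n] card_level_diagram[OF s True, of n]
          count_below_greedy_le[OF g s eq True, of n] eq[of n] by linarith
    next
      case False
      then have "{x \<in> level_set m n \<inter> ?G. d < snd x} = {}"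
        using diagram_column_le[OF gs] by fastforce
      then show ?thesis
        unfolding rows by (simp only: card.empty le0)
    qed
  qed
  then have "card {x \<in> ?G. fst x \<le> i} \<le> card {x \<in> ?S. fst x \<le> i}" for i
    using sum_levels[of g] sum_levels[of s] by (simp add: sum_mono)
  ultimately show ?thesis
    unfolding dominance_le_def sum_part_eq_card[OF part(1)] sum_part_eq_card[OF part(2)] by blast
qed

lemma row_eq_part:
  assumes "is_partition lam"
  shows "{j. (i, j) \<in> lam} = {1..part lam i}"
  unfolding Defs.part_def
proof (rule initial_segment_eq)
  note P = assms[unfolded is_partition_iff_down_closed]
  show "finite {j. (i, j) \<in> lam}"
    by (rule finite_subset[OF _ finite_imageI[of lam snd]]) (use P in force)+
  show "0 \<notin> {j. (i, j) \<in> lam}"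
    using P by (auto simp: is_position_def)
  show "j' \<in> {j. (i, j) \<in> lam}" if "j \<in> {j. (i, j) \<in> lam}" "1 \<le> j'" "j' \<le> j" for j j'
  proof -
    have "1 \<le> i"
      using P that(1) by (force simp: is_position_def)
    then show ?thesis
      using P that by blast
  qed
qed

lemma dominance_le_antisym:
  assumes "is_partition lam" "is_partition mu" "dominance_le lam mu" "dominance_le mu lam"
  shows "lam = mu"
proof -
  have sums: "(\<Sum>j = 1..i. part lam j) = (\<Sum>j = 1..i. part mu j)" for i
    using assms(3,4) by (auto simp: dominance_le_def intro: le_antisym)
  have "part lam (Suc i) = part mu (Suc i)" for i
    using sums[of i] sums[of "Suc i"] by simp
  then have "{j. (Suc i, j) \<in> lam} = {j. (Suc i, j) \<in> mu}" for i
    by (simp only: row_eq_part[OF assms(1)] row_eq_part[OF assms(2)])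
  moreover have "(0, j) \<notin> lam" "(0, j) \<notin> mu" for j
    using assms(1,2) by (auto simp: is_partition_iff_down_closed is_position_def)
  ultimately have "(i, j) \<in> lam \<longleftrightarrow> (i, j) \<in> mu" for i j
    by (cases i) auto
  then show ?thesis
    by auto
qed

section \<open>Regularization classes and the theorem\<close>

text \<open>A member of the class may have more columns than \<open>N\<close>, so both sequences are
  extended to a common bound \<open>M\<close> before their values are compared.\<close>

lemma reg_class_obtain_shape:
  assumes m: "0 < m" and s: "shape m N s" and "mu \<in> reg_class (Suc m) (diagram m s)"
  obtains M t where "N \<le> M" "shape m M t" "mu = diagram m t" "\<And>v. count_below t M v = count_below s M v"
proof -
  obtain N' t where t: "shape m N' t" "mu = diagram m t"
    using assms(3) is_partition_obtain_shape unfolding reg_class_def by blast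
  let ?M = "max N N'"
  have sh: "shape m ?M t" "shape m ?M s"
    using shape_extend t(1) s by (meson max.cobounded1 max.cobounded2)+
  have "\<forall>n. card (level_set m n \<inter> diagram m t) = card (level_set m n \<inter> diagram m s)"
    using assms(3) regularization_eq_iff[OF m] unfolding reg_class_def t(2) by blast
  then have "count_below t ?M v = count_below s ?M v" for v
    using level_counts_eq_iff[OF sh] by blast
  then show thesis
    using that[of ?M t] sh(1) t(2) by simp
qed

lemma diagram_in_reg_class:
  assumes "0 < m" "shape m N s" "shape m N t" "\<And>v. count_below t N v = count_below s N v"
  shows "diagram m t \<in> reg_class (Suc m) (diagram m s)"
  unfolding reg_class_def
  using is_partition_diagram[OF assms(3)] regularization_eq_iff[OF assms(1)]
    level_counts_eq_iff[OF assms(3,2)] assms(4) by blast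

theorem theorem3p6p2p5:
  fixes l :: nat and lam :: "position set"
  assumes "l \<ge> 3" and "is_partition lam"
  shows "lowering l lam \<in> reg_class l lam
    \<and> (\<forall>mu \<in> reg_class l lam. dominance_le (lowering l lam) mu)
    \<and> (\<forall>sig \<in> reg_class l lam. (\<forall>mu \<in> reg_class l lam. dominance_le sig mu) \<longrightarrow> sig = lowering l lam)
    \<and> locked l (lowering l lam) = lowering l lam
    \<and> (\<forall>sig \<in> reg_class l lam. locked l sig = sig \<longrightarrow> sig = lowering l lam)"
proof -
  define m where "m = l - 1"
  have l: "l = Suc m" and m: "0 < m"
    using assms(1) by (auto simp: m_def)
  obtain N s where s: "shape m N s" and lam: "lam = diagram m s"
    using is_partition_obtain_shape[OF assms(2)] by blast
  obtain g where g: "lockseq m N g g" and eq: "\<And>v. count_below g N v = count_below s N v"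
    using exists_greedy[OF s] by blast
  note gs = lockseq_shape[OF g]
  have low: "lowering l lam = diagram m g"
    unfolding l lam by (rule lowering_diagram[OF m s g eq])
  have mem: "diagram m g \<in> reg_class l lam"
    unfolding l lam by (rule diagram_in_reg_class[OF m s gs eq])
  have rep: thesis if mu: "mu \<in> reg_class l lam"
    and result: "\<And>M t. shape m M t \<Longrightarrow> mu = diagram m t \<Longrightarrow> lockseq m M g g \<Longrightarrow>
      (\<And>v. count_below g M v = count_below t M v) \<Longrightarrow> thesis" for mu thesis
  proof -
    obtain M t where M: "N \<le> M" "shape m M t" "mu = diagram m t" "\<And>v. count_below t M v = count_below s M v"
      using reg_class_obtain_shape[OF m s mu[unfolded l lam]] by blast
    \<comment> \<open>The agreement passes from \<open>N\<close> to \<open>M\<close> through the box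
      counts on levels, which do not depend on the bound.\<close>
    have "count_below g M v = count_below s M v" for v
      using eq level_counts_eq_iff[OF gs s] level_counts_eq_iff[OF shape_extend[OF gs M(1)] shape_extend[OF s M(1)]]
      by blast
    then show thesis
      using result[OF M(2,3) lockseq_extend[OF g M(1)]] M(4) by simp
  qed
  have least: "dominance_le (diagram m g) mu" if "mu \<in> reg_class l lam" for mu
    using that
  proof (rule rep)
    fix M t
    assume "shape m M t" "mu = diagram m t" "lockseq m M g g" "\<And>v. count_below g M v = count_below t M v"
    then show ?thesis
      using dominance_le_greedy[OF m] by blast
  qed
  have "sig = diagram m g"
    if "sig \<in> reg_class l lam" "\<forall>mu \<in> reg_class l lam. dominance_le sig mu" for sig
    using that mem least[OF that(1)] dominance_le_antisym unfolding reg_class_def by blast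
  moreover have "locked l (diagram m g) = diagram m g"
    unfolding l by (rule locked_diagram[OF m gs g])
  moreover have "sig = diagram m g" if "sig \<in> reg_class l lam" "locked l sig = sig" for sig
    using that(1)
  proof (rule rep)
    fix M t
    assume t: "shape m M t" "sig = diagram m t" and gM: "lockseq m M g g"
      and count_below: "\<And>v. count_below g M v = count_below t M v"
    obtain q where q: "lockseq m M t q"
      using exists_lockseq[OF t(1)] by blast
    have "diagram m q = diagram m t"
      using that(2) locked_diagram[OF m t(1) q] unfolding l t(2) by simp
    then have qt: "q b = t b" if "1 \<le> b" for b
      using diagram_inj[OF lockseq_shape[OF q] t(1)] that by blast
    \<comment> \<open>All boxes being locked, \<open>q\<close> and \<open>t\<close> agree on every
      column \<open>b \<ge> 1\<close>. Minimality among the values of \<open>t\<close> thus becomes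
      minimality among the values of \<open>q\<close>, so \<open>q\<close> is greedy.\<close>
    have "lockseq m M q q"
      unfolding lockseq_def
    proof (intro conjI ballI impI allI)
      fix b assume b: "b \<in> {1..M}"
      then show "q b \<in> q ` {1..b}" by auto
      show "q (Suc b) \<le> q b + m"
        using lockseqD(2)[OF q] b by simp
      show "q b \<le> q i" if "i \<in> {1..b}" "q (Suc b) \<le> q i + m" for i
        using lockseqD(3)[OF q, of b i] qt[of i] b that by simp
    qed (rule lockseq_tail[OF q])
    moreover have "{i \<in> {1..M}. q i < v} = {i \<in> {1..M}. t i < v}" for v
      using qt by auto
    then have "count_below q M v = count_below t M v" for v
      unfolding count_below_def by (rule arg_cong)
    then have "count_below q M v = count_below g M v" for v
      by (simp only: count_below)
    ultimately have "q b = g b" if "1 \<le> b" for b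
      using greedy_unique[OF _ gM] that by blast
    then have "diagram m q = diagram m g"
      unfolding diagram_def by auto
    then show ?thesis
      using \<open>diagram m q = diagram m t\<close> t(2) by simp
  qed
  ultimately show ?thesis
    unfolding low using mem least by blast
qed

end
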